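(* Let $p_1,p_2,\ldots$ be prediction strategies, let $\mathcal K_1\subseteq\mathcal K_2\subseteq\cdots\subseteq\mathbb Z^+$, and let $p_{\rm sw}$ denote the switch distribution relative to $p_1,p_2,\ldots$ with prior $\pi$. Suppose that $\pi$ is of the form $$\pi(\mathbf s)=\pi_{\rm M}(m)\,\pi_{\rm K}(k_1)\prod_{i=2}^m\pi_{\rm T}(t_i\mid t_i>t_{i-1})\,\pi_{\rm K}(k_i),$$ where $\pi_{\rm M}$, $\pi_{\rm K}$ and $\pi_{\rm T}$ are priors on $\mathbb Z^+$ with full support and $\pi_{\rm M}$ is geometric, $\pi_{\rm M}(m)=\theta^{m-1}(1-\theta)$ for some $0\le\theta<1$; and suppose that $\pi(\mathbb S\setminus\mathbb S')=0$, where $\mathbb S'=\{\mathbf s\in\mathbb S\mid\forall n\in\mathbb Z^+:K_n(\mathbf s)\in\mathcal K_n\}$. Then, on input $x^N$, Algorithm Switch (given in the context) correctly reports $p_{\rm sw}(K_1,x^0),\ldots,p_{\rm sw}(K_{N+1},x^N)$; that is, for each $n=1,\ldots,N+1$ and each $k\in\mathcal K_n$, the $n$-th reported value $w_k^a+w_k^b$ equals $p_{\rm sw}(K_n=k,x^{n-1})=\sum_{\mathbf s\in\mathbb S:K_n(\mathbf s)=k}q_{\mathbf s}(x^{n-1})\pi(\mathbf s)$.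
   Context: A prediction strategy $p$ assigns to each $n\in\mathbb N=\{0,1,\ldots\}$ and $x^n\in\mathcal X^n$ a density $p(X_{n+1}\mid x^n)$ for the next outcome. $\mathbb Z^+=\{1,2,\ldots\}$. $\mathbb{S}=\{((t_1,k_1),\ldots,(t_m,k_m))\in(\mathbb N\times\mathbb Z^+)^m\mid m\in\mathbb Z^+,\ 0=t_1<\cdots<t_m\}$. For $\mathbf s\in\mathbb S$ and $n\in\mathbb Z^+$, $K_n(\mathbf s)=k_i$ for the unique $i$ such that $t_i<n$ and ($i=m$ or $t_{i+1}\ge n$). $q_{\mathbf s}(x^n)=\prod_{i=1}^np_{K_i(\mathbf s)}(x_i\mid x^{i-1})$, with $q_{\mathbf s}(x^0)=1$. The switch distribution with prior $\pi$ (a probability mass function on $\mathbb S$) is given by $p_{\rm sw}(x^n,\mathbf s)=q_{\mathbf s}(x^n)\pi(\mathbf s)$. In the prior, $\pi_{\rm T}(t\mid t>t')=\pi_{\rm T}(t)/\sum_{u>t'}\pi_{\rm T}(u)$ for $t>t'$. For $n\in\mathbb Z^+$ let $h_n=\pi_{\rm T}(Z=n\mid Z\ge n)=\pi_{\rm T}(n)/\sum_{u\ge n}\pi_{\rm T}(u)$, so that $\pi_{\rm T}(Z\ne n\mid Z\ge n)=1-h_n$. $\mathbf 1_A$ is the indicator function of $A$. Algorithm Switch$(x^N)$: 1. For $k\in\mathcal K_1$: initialize $w_k^a\leftarrow\pi_{\rm K}(k)\,\theta$; $w_k^b\leftarrow\pi_{\rm K}(k)(1-\theta)$. 2. For $n=1,\ldots,N$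 do: (a) Report $p_{\rm sw}(K_n,x^{n-1})=w^a_{K_n}+w^b_{K_n}$ (an array indexed by $K_n\in\mathcal K_n$). (b) For $k\in\mathcal K_n$: $w_k^a\leftarrow w_k^a\cdot p_k(x_n\mid x^{n-1})$; $w_k^b\leftarrow w_k^b\cdot p_k(x_n\mid x^{n-1})$. (c) $\mathrm{pool}\leftarrow h_n\cdot\sum_{k\in\mathcal K_n}w_k^a$. (d) For $k\in\mathcal K_{n+1}$: $w_k^a\leftarrow w_k^a\cdot\mathbf 1_{\mathcal K_n}(k)\cdot(1-h_n)+\mathrm{pool}\cdot\pi_{\rm K}(k)\cdot\theta$; $w_k^b\leftarrow w_k^b\cdot\mathbf 1_{\mathcal K_n}(k)+\mathrm{pool}\cdot\pi_{\rm K}(k)\cdot(1-\theta)$ (the terms containing $\mathbf 1_{\mathcal K_n}(k)$ count as $0$ for $k\in\mathcal K_{n+1}\setminus\mathcal K_n$). 3. Report $p_{\rm sw}(K_{N+1},x^N)=w^a_{K_{N+1}}+w^b_{K_{N+1}}$. *)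

theory Defs
  imports "HOL-Probability.Probability"
begin

text \<open>
  \<open>P xs\<close> is the density of the next outcome given the past \<open>xs\<close>. The outcome space is
  \<open>space M\<close> and densities are taken with respect to \<open>M\<close>, so that mass functions (counting
  measure) and Lebesgue densities are both covered.
\<close>

definition prediction_strategy :: "'x measure \<Rightarrow> ('x list \<Rightarrow> 'x \<Rightarrow> real) \<Rightarrow> bool" where
  "prediction_strategy M P \<longleftrightarrow>
    (\<forall>xs \<in> lists (space M).
      P xs \<in> borel_measurable M \<and> (\<forall>x \<in> space M. 0 \<le> P xs x) \<and>
      (\<integral>\<^sup>+ x. ennreal (P xs x) \<partial>M) = 1)"

text \<open>
  The sequence \<open>((t\<^sub>1, k\<^sub>1), \<dots>, (t\<^sub>m, k\<^sub>m))\<close> is a list, whose positions count from 0: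
  \<open>(t\<^sub>i, k\<^sub>i)\<close> is \<open>s ! (i - 1)\<close>.
\<close>

definition switch_seqs :: "(nat \<times> nat) list set" where
  "switch_seqs = {s. s \<noteq> [] \<and> fst (hd s) = 0 \<and> sorted_wrt (<) (map fst s) \<and>
    (\<forall>(t, k) \<in> set s. 1 \<le> k)}"

definition active_at :: "nat \<Rightarrow> (nat \<times> nat) list \<Rightarrow> nat \<Rightarrow> bool" where
  "active_at n s i \<longleftrightarrow>
    i < length s \<and> fst (s ! i) < n \<and> (Suc i = length s \<or> n \<le> fst (s ! Suc i))"

definition model_at :: "nat \<Rightarrow> (nat \<times> nat) list \<Rightarrow> nat" where
  "model_at n s = snd (s ! (THE i. active_at n s i))"

lemma ex1_active_at:
  assumes "s \<in> switch_seqs" "1 \<le> n"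
  shows "\<exists>!i. active_at n s i"
proof -
  have ne: "s \<noteq> []" and z: "fst (s ! 0) = 0"
    and mono: "\<And>i j. i < j \<Longrightarrow> j < length s \<Longrightarrow> fst (s ! i) < fst (s ! j)"
    using assms(1) by (auto simp: switch_seqs_def hd_conv_nth sorted_wrt_iff_nth_less)
  let ?I = "{i. i < length s \<and> fst (s ! i) < n}"
  have fin: "finite ?I" and nonempty: "?I \<noteq> {}"
    using ne z assms(2) by auto
  have Max_in: "Max ?I \<in> ?I"
    using fin nonempty by (rule Max_in)
  moreover have "Suc (Max ?I) \<notin> ?I"
    using Max_ge[OF fin] by (meson Suc_n_not_le_n)
  ultimately have "active_at n s (Max ?I)"
    unfolding active_at_def by auto
  moreover have "\<not> (i < j \<and> active_at n s i \<and> active_at n s j)" for i j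
  proof
    assume a: "i < j \<and> active_at n s i \<and> active_at n s j"
    then have "n \<le> fst (s ! Suc i)"
      by (auto simp: active_at_def)
    moreover have "fst (s ! Suc i) \<le> fst (s ! j)"
      using a mono[of "Suc i" j] by (cases "Suc i = j") (auto simp: active_at_def)
    ultimately show False
      using a by (auto simp: active_at_def)
  qed
  ultimately show ?thesis
    by (metis linorder_neqE_nat)
qed

definition seq_density ::
    "(nat \<Rightarrow> 'x list \<Rightarrow> 'x \<Rightarrow> real) \<Rightarrow> (nat \<times> nat) list \<Rightarrow> 'x list \<Rightarrow> real" where
  "seq_density p s xs =
    (\<Prod>i = 1..length xs. p (model_at i s) (take (i - 1) xs) (xs ! (i - 1)))"

definition switch_density ::
    "(nat \<Rightarrow> 'x list \<Rightarrow> 'x \<Rightarrow> real) \<Rightarrow> (nat \<times> nat) list pmf \<Rightarrow> 'x list \<Rightarrow> (nat \<times> nat) list \<Rightarrow> real"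
    where
  "switch_density p \<pi> xs s = seq_density p s xs * pmf \<pi> s"

text \<open>
  The density values may be unbounded over the strategies, so this sum of nonnegative terms can
  diverge; it is therefore taken in \<open>[0, \<infinity>]\<close>.
\<close>

definition switch_marginal ::
    "(nat \<Rightarrow> 'x list \<Rightarrow> 'x \<Rightarrow> real) \<Rightarrow> (nat \<times> nat) list pmf \<Rightarrow> nat \<Rightarrow> nat \<Rightarrow> 'x list \<Rightarrow> ennreal"
    where
  "switch_marginal p \<pi> n k xs =
    (\<Sum>\<^sub>\<infinity> s \<in> {s \<in> switch_seqs. model_at n s = k}. ennreal (switch_density p \<pi> xs s))"

definition cond_after :: "nat pmf \<Rightarrow> nat \<Rightarrow> nat \<Rightarrow> real" where
  "cond_after \<pi>T t' t = pmf \<pi>T t / measure_pmf.prob \<pi>T {t'<..}"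

definition hazard :: "nat pmf \<Rightarrow> nat \<Rightarrow> real" where
  "hazard \<pi>T n = pmf \<pi>T n / measure_pmf.prob \<pi>T {n..}"

definition switch_prior ::
    "nat pmf \<Rightarrow> nat pmf \<Rightarrow> nat pmf \<Rightarrow> (nat \<times> nat) list \<Rightarrow> real" where
  "switch_prior \<pi>M \<pi>K \<pi>T s =
    pmf \<pi>M (length s) * pmf \<pi>K (snd (s ! 0)) *
    (\<Prod>i = 1..<length s. cond_after \<pi>T (fst (s ! (i - 1))) (fst (s ! i)) * pmf \<pi>K (snd (s ! i)))"

definition allowed_seqs :: "(nat \<Rightarrow> nat set) \<Rightarrow> (nat \<times> nat) list set" where
  "allowed_seqs \<K> = {s \<in> switch_seqs. \<forall>n \<ge> 1. model_at n s \<in> \<K> n}"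

text \<open>
  The state of the algorithm is the pair of arrays \<open>(w\<^sup>a, w\<^sup>b)\<close>. An array indexed by
  \<open>\<K> n\<close> is a function that is \<^const>\<open>undefined\<close> outside \<open>\<K> n\<close>.
\<close>

type_synonym weights = "(nat \<Rightarrow> ennreal) \<times> (nat \<Rightarrow> ennreal)"

definition switch_init :: "(nat \<Rightarrow> nat set) \<Rightarrow> real \<Rightarrow> nat pmf \<Rightarrow> weights" where
  "switch_init \<K> \<theta> \<pi>K =
    ((\<lambda>k \<in> \<K> 1. ennreal (pmf \<pi>K k) * ennreal \<theta>),
     (\<lambda>k \<in> \<K> 1. ennreal (pmf \<pi>K k) * ennreal (1 - \<theta>)))"

definition switch_report :: "(nat \<Rightarrow> nat set) \<Rightarrow> nat \<Rightarrow> weights \<Rightarrow> nat \<Rightarrow> ennreal" where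
  "switch_report \<K> n w = (\<lambda>k \<in> \<K> n. fst w k + snd w k)"

text \<open>Here \<open>xs\<close> is the past \<open>x\<^sub>1, \<dots>, x\<^sub>n\<^sub>-\<^sub>1\<close> and \<open>x\<close> is the new outcome \<open>x\<^sub>n\<close>.\<close>

definition switch_step ::
    "(nat \<Rightarrow> 'x list \<Rightarrow> 'x \<Rightarrow> real) \<Rightarrow> (nat \<Rightarrow> nat set) \<Rightarrow> real \<Rightarrow> nat pmf \<Rightarrow> nat pmf \<Rightarrow>
      nat \<Rightarrow> 'x list \<Rightarrow> 'x \<Rightarrow> weights \<Rightarrow> weights" where
  "switch_step p \<K> \<theta> \<pi>K \<pi>T n xs x w =
    (let a = (\<lambda>k \<in> \<K> n. fst w k * ennreal (p k xs x));
         b = (\<lambda>k \<in> \<K> n. snd w k * ennreal (p k xs x));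
         pool = ennreal (hazard \<pi>T n) * (\<Sum>\<^sub>\<infinity> k \<in> \<K> n. a k)
     in ((\<lambda>k \<in> \<K> (n + 1). a k * indicator (\<K> n) k * ennreal (1 - hazard \<pi>T n)
            + pool * ennreal (pmf \<pi>K k) * ennreal \<theta>),
         (\<lambda>k \<in> \<K> (n + 1). b k * indicator (\<K> n) k
            + pool * ennreal (pmf \<pi>K k) * ennreal (1 - \<theta>))))"

text \<open>
  The list of reports from iteration \<open>n\<close> on, given the past \<open>xs\<close> and the current weights \<open>w\<close>;
  the last argument of the recursion lists the outcomes still to come.
\<close>

fun switch_run ::
    "(nat \<Rightarrow> 'x list \<Rightarrow> 'x \<Rightarrow> real) \<Rightarrow> (nat \<Rightarrow> nat set) \<Rightarrow> real \<Rightarrow> nat pmf \<Rightarrow> nat pmf \<Rightarrow>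
      nat \<Rightarrow> 'x list \<Rightarrow> weights \<Rightarrow> 'x list \<Rightarrow> (nat \<Rightarrow> ennreal) list" where
  "switch_run p \<K> \<theta> \<pi>K \<pi>T n xs w [] = [switch_report \<K> n w]"
| "switch_run p \<K> \<theta> \<pi>K \<pi>T n xs w (x # ys) =
    switch_report \<K> n w #
    switch_run p \<K> \<theta> \<pi>K \<pi>T (n + 1) (xs @ [x]) (switch_step p \<K> \<theta> \<pi>K \<pi>T n xs x w) ys"

definition switch_algorithm ::
    "(nat \<Rightarrow> 'x list \<Rightarrow> 'x \<Rightarrow> real) \<Rightarrow> (nat \<Rightarrow> nat set) \<Rightarrow> real \<Rightarrow> nat pmf \<Rightarrow> nat pmf \<Rightarrow>
      'x list \<Rightarrow> (nat \<Rightarrow> ennreal) list" where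
  "switch_algorithm p \<K> \<theta> \<pi>K \<pi>T xs =
    switch_run p \<K> \<theta> \<pi>K \<pi>T 1 [] (switch_init \<K> \<theta> \<pi>K) xs"

end

theory Submission imports Defs
begin

text \<open>
  Fix a time \<open>n \<ge> 1\<close>. A switch sequence \<open>s\<close> is cut uniquely into a head \<open>r\<close>, its entries with switch time
  below \<open>n\<close>, and a tail \<open>l\<close>, its entries with switch time at least \<open>n\<close>. The model that \<open>s\<close> uses for
  \<open>x\<^sub>n\<close> is the last model of \<open>r\<close>, and \<open>q\<^sub>s(x\<^sup>n\<^sup>-\<^sup>1)\<close> depends on \<open>r\<close> alone, so in the marginal
  \<open>p\<^sub>s\<^sub>w(K\<^sub>n = k, x\<^sup>n\<^sup>-\<^sup>1)\<close> the tail can be summed out. The geometric prior factors over the entries of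
  \<open>s\<close>: each switch contributes a factor \<open>\<theta>\<close> and the end of the sequence a factor \<open>1 - \<theta>\<close>. Hence all
  continuations after a given switch have total prior mass 1, because those with \<open>m\<close> further switches
  have mass \<open>\<theta>\<^sup>m (1 - \<theta>)\<close> (\<open>tails_mass\<close>, where the common factor \<open>1 - \<theta>\<close> is divided out).
  If the last switch in \<open>r\<close> happens at time \<open>t\<close>, the continuations of \<open>r\<close> by a tail therefore have mass \<open>\<theta> P(Z \<ge> n) / P(Z > t)\<close> for the nonempty tails plus
  \<open>1 - \<theta>\<close> for the empty one (\<open>continuation_mass\<close>).

  These two summands are what the two arrays of the algorithm keep apart: at the start of iteration \<open>n\<close>,
  \<open>w\<^sup>a\<^sub>k\<close> is the total weight, over heads ending in \<open>k\<close>, of the sequences that switch again, and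
  \<open>w\<^sup>b\<^sub>k\<close> that of the sequences that have made their last switch (\<open>weights_correct\<close>). Their sum is the
  marginal. The invariant is preserved because a head at time \<open>n + 1\<close> is either a head at time \<open>n\<close>, or a
  head at time \<open>n\<close> extended by a switch at \<open>n\<close> itself (\<open>heads_Suc\<close>). In the first case the survival factor
  \<open>P(Z \<ge> n) / P(Z > t)\<close> is multiplied by \<open>1 - h\<^sub>n\<close>. In the second case it is multiplied by \<open>h\<^sub>n\<close>, which
  turns it into the prior of a switch at \<open>n\<close>, and the survival factor starts afresh at 1; the sum
  of these contributions over all heads at time \<open>n\<close> is the pool.

  The restriction to heads ending in \<open>\<K> n\<close> loses nothing: a sequence that starts in an arbitrary model
  \<open>k\<close> and never switches has positive prior probability, so the prior can only be concentrated on the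
  allowed sequences if \<open>\<K> n\<close> contains every \<open>k \<ge> 1\<close>.
\<close>

section \<open>Unordered sums of extended nonnegative reals\<close>

text \<open>
  The identification with an integral over a counting measure makes Tonelli's theorem and the
  linearity of the integral available for unordered sums.
\<close>

lemma infsum_ennreal_eq_nn_integral:
  fixes f :: "'a \<Rightarrow> ennreal"
  assumes "countable A"
  shows "infsum f A = (\<integral>\<^sup>+ x. f x \<partial>count_space A)"
proof (rule antisym)
  have sup: "infsum f A = (SUP F\<in>{F. finite F \<and> F \<subseteq> A}. sum f F)"
    by (rule nonneg_infsum_complete) simp
  have "sum f F \<le> (\<integral>\<^sup>+ x. f x \<partial>count_space A)" if "finite F" "F \<subseteq> A" for F
  proof -
    have "sum f F = (\<integral>\<^sup>+ x. f x \<partial>count_space F)"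
      using that by (simp add: nn_integral_count_space_finite)
    also have "\<dots> \<le> (\<integral>\<^sup>+ x. f x \<partial>count_space A)"
      using that by (auto simp: nn_integral_count_space_indicator split: split_indicator
          intro!: nn_integral_mono)
    finally show ?thesis .
  qed
  then show "infsum f A \<le> (\<integral>\<^sup>+ x. f x \<partial>count_space A)"
    unfolding sup by (intro SUP_least) auto
  show "(\<integral>\<^sup>+ x. f x \<partial>count_space A) \<le> infsum f A"
  proof (cases "finite A")
    case True
    then show ?thesis by (simp add: nn_integral_count_space_finite)
  next
    case False
    with assms have bij: "bij_betw (from_nat_into A) UNIV A"
      by (rule bij_betw_from_nat_into)
    have "(\<integral>\<^sup>+ x. f x \<partial>count_space A) = (\<Sum>i. f (from_nat_into A i))"
      using nn_integral_bij_count_space[OF bij, of f] by (simp add: nn_integral_count_space_nat)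
    also have "\<dots> = (SUP n. \<Sum>i<n. f (from_nat_into A i))"
      by (rule suminf_eq_SUP)
    also have "\<dots> \<le> infsum f A"
    proof (rule SUP_least)
      fix n
      have "inj_on (from_nat_into A) {..<n}"
        using bij by (metis bij_betw_def inj_on_subset subset_UNIV)
      then have "(\<Sum>i<n. f (from_nat_into A i)) = sum f (from_nat_into A ` {..<n})"
        by (simp add: sum.reindex)
      also have "\<dots> \<le> infsum f A"
        unfolding sup using bij by (intro SUP_upper) (auto simp: bij_betw_def)
      finally show "(\<Sum>i<n. f (from_nat_into A i)) \<le> infsum f A" .
    qed
    finally show ?thesis .
  qed
qed

lemma infsum_ennreal_cmult:
  fixes f :: "'a::countable \<Rightarrow> ennreal"
  shows "(\<Sum>\<^sub>\<infinity>x\<in>A. c * f x) = c * infsum f A"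
  by (simp add: infsum_ennreal_eq_nn_integral nn_integral_cmult)

lemma infsum_ennreal_multc:
  fixes f :: "'a::countable \<Rightarrow> ennreal"
  shows "(\<Sum>\<^sub>\<infinity>x\<in>A. f x * c) = infsum f A * c"
  by (simp add: infsum_ennreal_eq_nn_integral nn_integral_multc)

text \<open>
  Tonelli's theorem for a dependent family of index sets; as the terms are nonnegative, the order of
  summation is irrelevant even if a sum diverges.
\<close>

lemma infsum_ennreal_Sigma:
  fixes f :: "'a::countable \<times> 'b::countable \<Rightarrow> ennreal"
  shows "infsum f (Sigma A B) = (\<Sum>\<^sub>\<infinity>x\<in>A. \<Sum>\<^sub>\<infinity>y\<in>B x. f (x, y))"
proof -
  have "infsum f (Sigma A B) = (\<integral>\<^sup>+ z. f z * indicator (Sigma A B) z \<partial>count_space UNIV)"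
    by (subst infsum_ennreal_eq_nn_integral)
       (auto simp: nn_integral_count_space_indicator countableI_type)
  also have "\<dots> = (\<integral>\<^sup>+ x. \<integral>\<^sup>+ y. f (x, y) * indicator (Sigma A B) (x, y)
      \<partial>count_space UNIV \<partial>count_space UNIV)"
    by (subst nn_integral_fst_count_space[symmetric]) simp
  also have "\<dots> = (\<integral>\<^sup>+ x. (\<integral>\<^sup>+ y. f (x, y) * indicator (B x) y \<partial>count_space UNIV) * indicator A x
      \<partial>count_space UNIV)"
    by (intro nn_integral_cong) (auto simp: indicator_def)
  also have "\<dots> = (\<Sum>\<^sub>\<infinity>x\<in>A. \<Sum>\<^sub>\<infinity>y\<in>B x. f (x, y))"
    by (simp add: infsum_ennreal_eq_nn_integral countableI_type
        flip: nn_integral_count_space_indicator)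
  finally show ?thesis .
qed

lemma infsum_pmf: "(\<Sum>\<^sub>\<infinity>x\<in>A. ennreal (pmf P x)) = ennreal (measure_pmf.prob P A)"
  for P :: "'a::countable pmf"
  by (simp add: infsum_ennreal_eq_nn_integral countableI_type nn_integral_pmf
      measure_pmf.emeasure_eq_measure)

section \<open>Cutting a switch sequence at a time\<close>

definition heads :: "nat \<Rightarrow> nat \<Rightarrow> (nat \<times> nat) list set" where
  "heads n k = {r \<in> switch_seqs. (\<forall>(t, _) \<in> set r. t < n) \<and> snd (last r) = k}"

definition tails :: "nat \<Rightarrow> (nat \<times> nat) list set" where
  "tails n = {l. sorted_wrt (<) (map fst l) \<and> (\<forall>(t, k) \<in> set l. n \<le> t \<and> 1 \<le> k)}"

lemma model_at_eqI:
  assumes "s \<in> switch_seqs" "1 \<le> n" "active_at n s i"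
  shows "model_at n s = snd (s ! i)"
  using the1_equality[OF ex1_active_at[OF assms(1,2)] assms(3)] by (simp add: model_at_def)

lemma model_at_pos:
  assumes "s \<in> switch_seqs" "1 \<le> n"
  shows "1 \<le> model_at n s"
proof -
  obtain i where i: "active_at n s i"
    using ex1_active_at[OF assms] by blast
  then have "s ! i \<in> set s"
    by (simp add: active_at_def)
  with assms(1) have "1 \<le> snd (s ! i)"
    by (auto simp: switch_seqs_def)
  with model_at_eqI[OF assms i] show ?thesis by simp
qed

lemma model_at_head:
  assumes "r \<in> heads n k" "1 \<le> n"
  shows "model_at n r = k"
proof -
  have r: "r \<in> switch_seqs" "r \<noteq> []" "snd (last r) = k" "\<forall>(t, _) \<in> set r. t < n"
    using assms(1) by (auto simp: heads_def switch_seqs_def)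
  have "r ! (length r - 1) \<in> set r"
    using r(2) by simp
  then have "active_at n r (length r - 1)"
    using r by (fastforce simp: active_at_def)
  from model_at_eqI[OF r(1) assms(2) this] r show ?thesis
    by (simp add: last_conv_nth)
qed

lemma append_tail_in_switch_seqs:
  assumes "r \<in> heads n k" "l \<in> tails n"
  shows "r @ l \<in> switch_seqs"
  using assms by (fastforce simp: heads_def tails_def switch_seqs_def sorted_wrt_append)

text \<open>
  What happens from time \<open>n\<close> on becomes effective only for \<open>x\<^sub>n\<^sub>+\<^sub>1\<close>, because entry \<open>(t, k)\<close> governs the
  outcomes with index strictly greater than \<open>t\<close>.
\<close>

lemma model_at_append_tail:
  assumes r: "r \<in> heads n k" and l: "l \<in> tails n" and i: "1 \<le> i" "i \<le> n"
  shows "model_at i (r @ l) = model_at i r"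
proof -
  have rs: "r \<in> switch_seqs" using r by (simp add: heads_def)
  obtain j where j: "active_at i r j"
    using ex1_active_at[OF rs i(1)] by blast
  have first: "n \<le> fst (l ! 0)" if "l \<noteq> []"
    using l that by (cases l) (auto simp: tails_def)
  have "active_at i (r @ l) j"
    using j first i(2) by (cases "l = []"; cases "Suc j = length r") (auto simp: active_at_def nth_append)
  from model_at_eqI[OF append_tail_in_switch_seqs[OF r l] i(1) this]
    model_at_eqI[OF rs i(1) j] j
  show ?thesis by (simp add: active_at_def nth_append)
qed

text \<open>
  Since the active model is determined by the head alone, the sequences that use model \<open>k\<close> at time \<open>n\<close>
  form a full product: any head ending in \<open>k\<close> may be combined with any tail.
\<close>

lemma bij_betw_append_heads_tails:
  assumes "1 \<le> n"
  shows "bij_betw (\<lambda>(r, l). r @ l) (heads n k \<times> tails n) {s \<in> switch_seqs. model_at n s = k}"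
proof -
  (* the cut is found by splitting at the first switch time that is not below n *)
  define P where "P = (\<lambda>(t, _::nat). t < n)"
  let ?cut = "\<lambda>s. (takeWhile P s, dropWhile P s)"
  have cut_append: "?cut (r @ l) = (r, l)" if "r \<in> heads n k" "l \<in> tails n" for r l
  proof -
    have r: "\<forall>x\<in>set r. P x" using that(1) by (auto simp: heads_def P_def)
    have "takeWhile P l = []"
      using that(2) by (cases l) (auto simp: tails_def P_def)
    moreover from this have "dropWhile P l = l"
      by (metis append_Nil takeWhile_dropWhile_id)
    ultimately show ?thesis using r by simp
  qed
  have cut_in: "?cut s \<in> heads n k \<times> tails n"
    if s: "s \<in> switch_seqs" and k: "model_at n s = k" for s
  proof -
    have pos: "\<forall>(t, k) \<in> set s. 1 \<le> k" and hd: "s \<noteq> []" "fst (hd s) = 0"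
      and srt: "sorted_wrt (<) (map fst (takeWhile P s @ dropWhile P s))"
      using s by (auto simp: switch_seqs_def)
    have srt': "sorted_wrt (<) (map fst (takeWhile P s))" "sorted_wrt (<) (map fst (dropWhile P s))"
      using srt by (simp_all only: map_append sorted_wrt_append)
    have "P (hd s)" using hd assms by (auto simp: P_def split: prod.splits)
    then have ne: "takeWhile P s \<noteq> []" "hd (takeWhile P s) = hd s"
      using hd(1) by (cases s; simp)+
    have "takeWhile P s \<in> switch_seqs"
      using ne hd srt' pos by (auto simp: switch_seqs_def dest: set_takeWhileD)
    then have pre: "takeWhile P s \<in> heads n (snd (last (takeWhile P s)))"
      by (auto simp: heads_def P_def dest: set_takeWhileD)
    have "n \<le> t" if "(t, m) \<in> set (dropWhile P s)" for t m
    proof -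
      from that have dne: "dropWhile P s \<noteq> []" by (metis list.set_cases list.discI)
      then obtain t0 m0 d where d: "dropWhile P s = (t0, m0) # d"
        by (cases "dropWhile P s") auto
      with dne hd_dropWhile[OF dne] have "n \<le> t0" by (auto simp: P_def)
      moreover have "t0 \<le> t" using srt'(2) that d by fastforce
      ultimately show ?thesis by simp
    qed
    then have tail: "dropWhile P s \<in> tails n"
      using srt' pos by (auto simp: tails_def dest: set_dropWhileD)
    have "snd (last (takeWhile P s)) = k"
      using model_at_append_tail[OF pre tail assms order_refl] model_at_head[OF pre assms] k
      by simp
    with pre tail show ?thesis by simp
  qed
  show ?thesis
  proof (rule bij_betw_byWitness[where f' = ?cut])
    show "(\<lambda>(r, l). r @ l) ` (heads n k \<times> tails n) \<subseteq> {s \<in> switch_seqs. model_at n s = k}"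
      using append_tail_in_switch_seqs model_at_append_tail[OF _ _ assms order_refl]
        model_at_head[OF _ assms] by auto
  qed (use cut_append cut_in in auto)
qed

lemma heads_Suc_0: "1 \<le> k \<Longrightarrow> heads (Suc 0) k = {[(0, k)]}"
proof (intro equalityI subsetI)
  fix r assume r: "r \<in> heads (Suc 0) k"
  then obtain a r' where "r = a # r'"
    by (cases r) (auto simp: heads_def switch_seqs_def)
  with r show "r \<in> {[(0, k)]}"
    by (cases r') (auto simp: heads_def switch_seqs_def)
qed (auto simp: heads_def switch_seqs_def)

lemma singleton_tail: "1 \<le> k \<Longrightarrow> [(n, k)] \<in> tails n"
  by (simp add: tails_def)

text \<open>
  Switch times increase strictly, so the only new possibility at time \<open>n + 1\<close> is that the last switch
  happened at \<open>n\<close> exactly, and then all earlier ones happened before \<open>n\<close>.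
\<close>

lemma heads_Suc:
  assumes "1 \<le> n" "1 \<le> k"
  shows "heads (Suc n) k = heads n k \<union> (\<lambda>r. r @ [(n, k)]) ` (\<Union>j\<in>{1..}. heads n j)"
    (is "?L = ?R")
proof (intro equalityI subsetI)
  fix s assume s: "s \<in> ?L"
  show "s \<in> ?R"
  proof (cases "s \<in> heads n k")
    case False
    obtain r t m where snoc: "s = r @ [(t, m)]"
      using s by (cases s rule: rev_cases) (auto simp: heads_def switch_seqs_def)
    have sw: "s \<in> switch_seqs" and m: "m = k" and lt: "\<forall>(t, _)\<in>set s. t < Suc n"
      using s snoc by (auto simp: heads_def)
    have before: "u < t" if "(u, j) \<in> set r" for u j
      using sw snoc that by (fastforce simp: switch_seqs_def sorted_wrt_append)
    have t: "t = n"
    proof (rule ccontr)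
      assume "t \<noteq> n"
      with lt snoc have "t < n" by auto
      with before snoc have "\<forall>(t, _)\<in>set s. t < n" by fastforce
      with s False show False by (auto simp: heads_def)
    qed
    have "r \<noteq> []"
      using sw snoc t assms(1) by (auto simp: switch_seqs_def)
    then have "r \<in> switch_seqs" "1 \<le> snd (last r)"
      using sw snoc last_in_set[of r]
      by (auto simp: switch_seqs_def sorted_wrt_append split_beta simp del: last_in_set)
    with before t have "r \<in> heads n (snd (last r))" "snd (last r) \<in> {1..}"
      by (auto simp: heads_def)
    then show ?thesis unfolding snoc t m by blast
  qed simp
next
  fix s assume "s \<in> ?R"
  then consider "s \<in> heads n k" | r j where "r \<in> heads n j" "s = r @ [(n, k)]"
    by auto
  then show "s \<in> ?L"
  proof cases
    case 1
    then show ?thesis by (auto simp: heads_def)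
  next
    case 2
    then show ?thesis
      using append_tail_in_switch_seqs[OF 2(1) singleton_tail[OF assms(2)]]
      by (auto simp: heads_def)
  qed
qed

lemma infsum_heads_Suc:
  fixes f :: "(nat \<times> nat) list \<Rightarrow> ennreal"
  assumes "1 \<le> n" "1 \<le> k"
  shows "infsum f (heads (Suc n) k) =
    infsum f (heads n k) + (\<Sum>\<^sub>\<infinity>j\<in>{1..}. \<Sum>\<^sub>\<infinity>r\<in>heads n j. f (r @ [(n, k)]))"
proof -
  have "infsum f ((\<lambda>r. r @ [(n, k)]) ` (\<Union>j\<in>{1..}. heads n j))
      = (\<Sum>\<^sub>\<infinity>r\<in>(\<Union>j\<in>{1..}. heads n j). f (r @ [(n, k)]))"
    by (subst infsum_reindex) (auto simp: inj_on_def o_def)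
  also have "\<dots> = (\<Sum>\<^sub>\<infinity>z\<in>Sigma {1..} (heads n). f (snd z @ [(n, k)]))"
  proof (rule infsum_reindex_bij_betw[symmetric])
    show "bij_betw snd (Sigma {1..} (heads n)) (\<Union>j\<in>{1..}. heads n j)"
      by (force simp: bij_betw_def inj_on_def heads_def)
  qed
  also have "\<dots> = (\<Sum>\<^sub>\<infinity>j\<in>{1..}. \<Sum>\<^sub>\<infinity>r\<in>heads n j. f (r @ [(n, k)]))"
    by (simp add: infsum_ennreal_Sigma)
  finally have new: "infsum f ((\<lambda>r. r @ [(n, k)]) ` (\<Union>j\<in>{1..}. heads n j)) = \<dots>" .
  have "heads n k \<inter> (\<lambda>r. r @ [(n, k)]) ` (\<Union>j\<in>{1..}. heads n j) = {}"
    by (auto simp: heads_def)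
  with new show ?thesis
    unfolding heads_Suc[OF assms]
    by (subst infsum_Un_disjoint) (auto intro: nonneg_summable_on_complete)
qed

text \<open>
  The constraint \<open>Q\<close> on the rest serves to restrict the length of the tail in inductive arguments.
\<close>

lemma bij_betw_Cons_tails:
  "bij_betw (\<lambda>(x, l). x # l) (Sigma ({n..} \<times> {1..}) (\<lambda>(t, k). {l \<in> tails (Suc t). Q l}))
     {l \<in> tails n. l \<noteq> [] \<and> Q (tl l)}"
  by (rule bij_betw_byWitness[where f' = "\<lambda>l. (hd l, tl l)"])
     (auto simp: tails_def neq_Nil_conv Suc_le_eq less_imp_le split: prod.splits intro: order.trans, fastforce+)

lemma seq_density_snoc:
  "seq_density p s (xs @ [x]) = seq_density p s xs * p (model_at (Suc (length xs)) s) xs x"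
proof -
  have "(\<Prod>i = 1..length xs. p (model_at i s) (take (i - 1) (xs @ [x])) ((xs @ [x]) ! (i - 1)))
      = (\<Prod>i = 1..length xs. p (model_at i s) (take (i - 1) xs) (xs ! (i - 1)))"
    by (intro prod.cong) (auto simp: nth_append)
  then show ?thesis by (simp add: seq_density_def)
qed

lemma seq_density_append_tail:
  assumes "r \<in> heads n k" "l \<in> tails n" "length xs \<le> n"
  shows "seq_density p (r @ l) xs = seq_density p r xs"
  unfolding seq_density_def
  using assms by (intro prod.cong) (auto simp: model_at_append_tail[OF assms(1,2)])


section \<open>Mass of the continuations of a switch sequence\<close>

lemma switch_seqs_Cons:
  assumes "s \<in> switch_seqs"
  obtains k l where "s = (0, k) # l"
  using assms by (cases s) (auto simp: switch_seqs_def)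

text \<open>
  The conditional probability \<open>P(Z \<ge> n | Z > t)\<close>, provided that \<open>t < n\<close>.
\<close>

definition survival :: "nat pmf \<Rightarrow> nat \<Rightarrow> nat \<Rightarrow> real" where
  "survival \<pi>T t n = measure_pmf.prob \<pi>T {n..} / measure_pmf.prob \<pi>T {t<..}"

text \<open>
  The prior contribution of a run of switches \<open>l\<close> whose predecessor happened at time \<open>t\<close>. Every switch
  carries its own factor \<open>\<theta>\<close>, so that weights multiply when runs are concatenated; the factor \<open>1 - \<theta>\<close>
  for ending the sequence is left out for the same reason.
\<close>

fun path_weight :: "real \<Rightarrow> nat pmf \<Rightarrow> nat pmf \<Rightarrow> nat \<Rightarrow> (nat \<times> nat) list \<Rightarrow> real" where
  "path_weight \<theta> \<pi>K \<pi>T t [] = 1"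
| "path_weight \<theta> \<pi>K \<pi>T t ((u, k) # l) =
    \<theta> * cond_after \<pi>T t u * pmf \<pi>K k * path_weight \<theta> \<pi>K \<pi>T u l"

definition seq_weight :: "real \<Rightarrow> nat pmf \<Rightarrow> nat pmf \<Rightarrow> (nat \<times> nat) list \<Rightarrow> real" where
  "seq_weight \<theta> \<pi>K \<pi>T s = pmf \<pi>K (snd (hd s)) * path_weight \<theta> \<pi>K \<pi>T 0 (tl s)"

lemma path_weight_append:
  "path_weight \<theta> \<pi>K \<pi>T t (l @ l') =
    path_weight \<theta> \<pi>K \<pi>T t l * path_weight \<theta> \<pi>K \<pi>T (last (t # map fst l)) l'"
  by (induction l arbitrary: t) auto

lemma seq_weight_append:
  assumes "r \<in> switch_seqs"
  shows "seq_weight \<theta> \<pi>K \<pi>T (r @ l) = seq_weight \<theta> \<pi>K \<pi>T r * path_weight \<theta> \<pi>K \<pi>T (fst (last r)) l"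
proof -
  obtain k r' where r: "r = (0, k) # r'"
    using assms by (rule switch_seqs_Cons)
  have "last (0 # map fst r') = fst (last r)"
    unfolding r by (simp add: last_map)
  then show ?thesis
    unfolding seq_weight_def r by (simp add: path_weight_append)
qed

lemma path_weight_eq_prod:
  "path_weight \<theta> \<pi>K \<pi>T t l =
    \<theta> ^ length l * (\<Prod>i = 1..length l.
      cond_after \<pi>T (fst (((t, k) # l) ! (i - 1))) (fst (((t, k) # l) ! i)) * pmf \<pi>K (snd (((t, k) # l) ! i)))"
proof (induction l arbitrary: t k)
  case (Cons x l)
  obtain u j where x: "x = (u, j)" by fastforce
  let ?f = "\<lambda>i. cond_after \<pi>T (fst (((t, k) # x # l) ! (i - 1))) (fst (((t, k) # x # l) ! i))
    * pmf \<pi>K (snd (((t, k) # x # l) ! i))"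
  have "(\<Prod>i = 1..length (x # l). ?f i) = ?f 1 * (\<Prod>i = Suc 1..Suc (length l). ?f i)"
    by (subst prod.atLeast_Suc_atMost) auto
  also have "(\<Prod>i = Suc 1..Suc (length l). ?f i) = (\<Prod>i = 1..length l. ?f (Suc i))"
    by (rule prod.shift_bounds_cl_Suc_ivl)
  also have "\<dots> = (\<Prod>i = 1..length l. cond_after \<pi>T (fst ((x # l) ! (i - 1))) (fst ((x # l) ! i))
      * pmf \<pi>K (snd ((x # l) ! i)))"
    by (intro prod.cong) (auto simp: nth_Cons')
  finally show ?case
    using Cons.IH[of u j] by (simp add: x mult_ac)
qed simp

lemma switch_prior_eq_seq_weight:
  assumes "s \<in> switch_seqs"
    and geometric: "\<And>m. 1 \<le> m \<Longrightarrow> pmf \<pi>M m = \<theta> ^ (m - 1) * (1 - \<theta>)"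
  shows "switch_prior \<pi>M \<pi>K \<pi>T s = seq_weight \<theta> \<pi>K \<pi>T s * (1 - \<theta>)"
proof -
  obtain k l where s: "s = (0, k) # l"
    using assms(1) by (rule switch_seqs_Cons)
  have "{1..<length s} = {1..length l}" by (auto simp: s)
  then show ?thesis
    unfolding switch_prior_def seq_weight_def s
    by (simp add: path_weight_eq_prod[of _ _ _ 0 l k] geometric)
qed

locale switch_weights =
  fixes \<pi>K \<pi>T :: "nat pmf" and \<theta> :: real
  assumes supp_K: "set_pmf \<pi>K = {1..}"
    and supp_T: "set_pmf \<pi>T = {1..}"
    and theta: "0 \<le> \<theta>" "\<theta> < 1"
begin

abbreviation "pathw \<equiv> path_weight \<theta> \<pi>K \<pi>T"
abbreviation "seqw \<equiv> seq_weight \<theta> \<pi>K \<pi>T"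
abbreviation "surv \<equiv> survival \<pi>T"

lemma prob_T_pos: "0 < measure_pmf.prob \<pi>T {n..}"
proof -
  have "max 1 n \<in> set_pmf \<pi>T \<inter> {n..}" using supp_T by simp
  then have "measure_pmf.prob \<pi>T {n..} \<noteq> 0"
    unfolding measure_pmf_zero_iff by blast
  then show ?thesis by (simp add: zero_less_measure_iff)
qed

lemma prob_T_Suc: "measure_pmf.prob \<pi>T {n..} = pmf \<pi>T n + measure_pmf.prob \<pi>T {Suc n..}"
proof -
  have "{n..} = {n} \<union> {Suc n..}" by auto
  then show ?thesis
    using measure_pmf.finite_measure_Union[of "{n}" \<pi>T "{Suc n..}"]
    by (simp add: measure_pmf_single)
qed

lemma survival_Suc_self: "surv t (Suc t) = 1"
  using prob_T_pos[of "Suc t"] by (simp add: survival_def atLeast_Suc_greaterThan)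

text \<open>
  Among the sequences whose next switch happens at \<open>n\<close> or later, the fraction \<open>h\<^sub>n\<close> switches at \<open>n\<close>; the
  survival probability and the hazard rate recombine to the prior of that switch.
\<close>

lemma survival_hazard: "surv t n * hazard \<pi>T n = cond_after \<pi>T t n"
  using prob_T_pos[of n] by (simp add: survival_def hazard_def cond_after_def)

lemma survival_no_hazard: "surv t n * (1 - hazard \<pi>T n) = surv t (Suc n)"
proof -
  have "1 - hazard \<pi>T n = measure_pmf.prob \<pi>T {Suc n..} / measure_pmf.prob \<pi>T {n..}"
    using prob_T_pos[of n] prob_T_Suc[of n] by (simp add: hazard_def field_simps)
  then show ?thesis
    using prob_T_pos[of n] by (simp add: survival_def)
qed

lemma hazard_bounds: "0 \<le> hazard \<pi>T n" "hazard \<pi>T n \<le> 1"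
  using prob_T_pos[of n] prob_T_Suc[of n] by (auto simp: hazard_def)

lemma survival_nonneg: "0 \<le> surv t n"
  by (simp add: survival_def)

lemma cond_after_nonneg: "0 \<le> cond_after \<pi>T t n"
  by (simp add: cond_after_def)

lemma path_nonneg: "0 \<le> pathw t l"
  using theta by (induction l arbitrary: t) (auto simp: cond_after_nonneg)

lemma seq_nonneg: "0 \<le> seqw s"
  by (simp add: seq_weight_def path_nonneg)

lemma infsum_cond_after: "(\<Sum>\<^sub>\<infinity>t\<in>{n..}. ennreal (cond_after \<pi>T u t)) = ennreal (surv u n)"
proof -
  have "ennreal (cond_after \<pi>T u t) = ennreal (pmf \<pi>T t) * ennreal (1 / measure_pmf.prob \<pi>T {u<..})" for t
    by (simp add: cond_after_def ennreal_mult[symmetric])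
  then show ?thesis
    by (simp only: infsum_ennreal_multc infsum_pmf) (simp add: survival_def ennreal_mult[symmetric])
qed

lemma infsum_pmf_K: "(\<Sum>\<^sub>\<infinity>k\<in>{1..}. ennreal (pmf \<pi>K k)) = 1"
  unfolding infsum_pmf using supp_K by (simp add: measure_pmf.prob_eq_1 AE_measure_pmf_iff)

text \<open>
  The first switch of a nonempty tail is summed out: its model has total mass 1 and its time has total
  mass \<open>surv u n\<close>, provided that the mass \<open>c\<close> of what follows does not depend on when it happens.
\<close>

lemma nonempty_tails_mass:
  assumes "\<And>t. (\<Sum>\<^sub>\<infinity>l\<in>{l \<in> tails (Suc t). Q l}. ennreal (pathw t l)) = c"
  shows "(\<Sum>\<^sub>\<infinity>l\<in>{l \<in> tails n. l \<noteq> [] \<and> Q (tl l)}. ennreal (pathw u l)) = ennreal (\<theta> * surv u n) * c"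
proof -
  have "(\<Sum>\<^sub>\<infinity>l\<in>{l \<in> tails n. l \<noteq> [] \<and> Q (tl l)}. ennreal (pathw u l))
      = (\<Sum>\<^sub>\<infinity>z\<in>Sigma ({n..} \<times> {1..}) (\<lambda>(t, k). {l \<in> tails (Suc t). Q l}).
          ennreal (pathw u ((\<lambda>(x, l). x # l) z)))"
    by (rule infsum_reindex_bij_betw[OF bij_betw_Cons_tails, symmetric])
  also have "\<dots> = (\<Sum>\<^sub>\<infinity>x\<in>{n..} \<times> {1..}. \<Sum>\<^sub>\<infinity>l\<in>{l \<in> tails (Suc (fst x)). Q l}. ennreal (pathw u (x # l)))"
    by (simp add: infsum_ennreal_Sigma case_prod_unfold)
  also have "\<dots> = (\<Sum>\<^sub>\<infinity>(t, k)\<in>Sigma {n..} (\<lambda>_. {1..}). ennreal \<theta> * ennreal (cond_after \<pi>T u t) * ennreal (pmf \<pi>K k) * c)"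
  proof (rule infsum_cong, clarify)
    fix t k
    have "ennreal (pathw u ((t, k) # l))
        = (ennreal \<theta> * ennreal (cond_after \<pi>T u t) * ennreal (pmf \<pi>K k)) * ennreal (pathw t l)" for l
      using theta by (simp add: ennreal_mult cond_after_nonneg path_nonneg)
    then show "(\<Sum>\<^sub>\<infinity>l\<in>{l \<in> tails (Suc (fst (t, k))). Q l}. ennreal (pathw u ((t, k) # l)))
        = ennreal \<theta> * ennreal (cond_after \<pi>T u t) * ennreal (pmf \<pi>K k) * c"
      by (simp only: infsum_ennreal_cmult assms fst_conv)
  qed
  also have "\<dots> = ennreal \<theta> * ennreal (surv u n) * c"
    by (simp only: infsum_ennreal_Sigma infsum_ennreal_multc infsum_ennreal_cmult
        infsum_pmf_K infsum_cond_after mult_1_right prod.case)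
  finally show ?thesis
    using theta by (simp add: ennreal_mult survival_nonneg)
qed

text \<open>
  The number of further switches has to be fixed first. The recursion for the mass of all tails together
  is, for \<open>\<theta> > 0\<close>, also solved by infinity and does not determine it.
\<close>

lemma tails_mass_length:
  "(\<Sum>\<^sub>\<infinity>l\<in>{l \<in> tails (Suc t). length l = m}. ennreal (pathw t l)) = ennreal (\<theta> ^ m)"
proof (induction m arbitrary: t)
  case 0
  have "{l \<in> tails (Suc t). length l = 0} = {[]}" by (auto simp: tails_def)
  then show ?case by simp
next
  case (Suc m)
  have "{l \<in> tails (Suc t). length l = Suc m} = {l \<in> tails (Suc t). l \<noteq> [] \<and> length (tl l) = m}"
    by auto
  then show ?case
    using theta
    by (simp only: nonempty_tails_mass[OF Suc.IH] survival_Suc_self) (simp add: ennreal_mult[symmetric])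
qed

lemma tails_mass: "(\<Sum>\<^sub>\<infinity>l\<in>tails (Suc t). ennreal (pathw t l)) = ennreal (1 / (1 - \<theta>))"
proof -
  have "(\<Sum>\<^sub>\<infinity>l\<in>tails (Suc t). ennreal (pathw t l))
      = (\<Sum>\<^sub>\<infinity>z\<in>Sigma UNIV (\<lambda>m. {l \<in> tails (Suc t). length l = m}). ennreal (pathw t (snd z)))"
    by (rule infsum_reindex_bij_betw[symmetric]) (auto simp: bij_betw_def inj_on_def image_iff)
  also have "\<dots> = (\<Sum>\<^sub>\<infinity>m. ennreal (\<theta> ^ m))"
    unfolding tails_mass_length[of t, symmetric]
    by (simp add: infsum_ennreal_Sigma)
  also have "\<dots> = (\<Sum>m. ennreal (\<theta> ^ m))"
    by (simp add: infsum_ennreal_eq_nn_integral nn_integral_count_space_nat)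
  also have "\<dots> = ennreal (1 / (1 - \<theta>))"
    using theta geometric_sums[of \<theta>] by (intro suminf_ennreal_eq) auto
  finally show ?thesis .
qed

text \<open>
  The two summands belong to the nonempty tails and to the empty tail. The factor \<open>1 - \<theta>\<close> for the end
  of the sequence cancels the total \<open>1 / (1 - \<theta>)\<close> of the geometric series.
\<close>

lemma continuation_mass:
  "(\<Sum>\<^sub>\<infinity>l\<in>tails n. ennreal (pathw u l * (1 - \<theta>))) = ennreal (\<theta> * surv u n + (1 - \<theta>))"
proof -
  have "(\<Sum>\<^sub>\<infinity>l\<in>tails n. ennreal (pathw u l))
      = (\<Sum>\<^sub>\<infinity>l\<in>{[]} \<union> {l \<in> tails n. l \<noteq> [] \<and> True}. ennreal (pathw u l))"
    by (rule infsum_cong_neutral) (auto simp: tails_def)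
  also have "\<dots> = 1 + ennreal (\<theta> * surv u n) * ennreal (1 / (1 - \<theta>))"
    using nonempty_tails_mass[of "\<lambda>_. True" "ennreal (1 / (1 - \<theta>))" u n] tails_mass
    by (subst infsum_Un_disjoint) (auto intro: nonneg_summable_on_complete)
  finally have mass: "(\<Sum>\<^sub>\<infinity>l\<in>tails n. ennreal (pathw u l))
      = 1 + ennreal (\<theta> * surv u n) * ennreal (1 / (1 - \<theta>))" .
  have scale: "(1 + ennreal a * ennreal b) * ennreal c = ennreal ((1 + a * b) * c)"
    if "0 \<le> a" "0 \<le> b" "0 \<le> c" for a b c
    using that by (simp add: ennreal_mult ennreal_plus)
  have "(\<Sum>\<^sub>\<infinity>l\<in>tails n. ennreal (pathw u l) * ennreal (1 - \<theta>))
      = ennreal ((1 + \<theta> * surv u n * (1 / (1 - \<theta>))) * (1 - \<theta>))"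
    unfolding infsum_ennreal_multc mass using theta survival_nonneg[of u n] by (intro scale) auto
  moreover have "(1 + \<theta> * surv u n * (1 / (1 - \<theta>))) * (1 - \<theta>) = \<theta> * surv u n + (1 - \<theta>)"
    using theta by (simp add: field_simps)
  ultimately show ?thesis
    using theta by (simp add: ennreal_mult path_nonneg)
qed


text \<open>
  The tails can be summed out because the density of the first \<open>n\<close> outcomes does not see them.
\<close>

lemma switch_marginal_eq_infsum_heads:
  assumes n: "1 \<le> n" "length xs \<le> n"
    and prior: "\<And>s. s \<in> switch_seqs \<Longrightarrow> pmf \<pi> s = seqw s * (1 - \<theta>)"
    and nonneg: "\<And>s. s \<in> switch_seqs \<Longrightarrow> 0 \<le> seq_density p s xs"
  shows "switch_marginal p \<pi> n k xs =
    (\<Sum>\<^sub>\<infinity>r\<in>heads n k. ennreal (seq_density p r xs * seqw r * (\<theta> * surv (fst (last r)) n + (1 - \<theta>))))"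
proof -
  have "switch_marginal p \<pi> n k xs
      = (\<Sum>\<^sub>\<infinity>z\<in>heads n k \<times> tails n. ennreal (switch_density p \<pi> xs ((\<lambda>(r, l). r @ l) z)))"
    unfolding switch_marginal_def
    by (rule infsum_reindex_bij_betw[OF bij_betw_append_heads_tails[OF n(1)], symmetric])
  also have "\<dots> = (\<Sum>\<^sub>\<infinity>r\<in>heads n k. \<Sum>\<^sub>\<infinity>l\<in>tails n. ennreal (switch_density p \<pi> xs (r @ l)))"
    by (simp add: infsum_ennreal_Sigma)
  also have "\<dots> = (\<Sum>\<^sub>\<infinity>r\<in>heads n k. ennreal (seq_density p r xs * seqw r * (\<theta> * surv (fst (last r)) n + (1 - \<theta>))))"
  proof (rule infsum_cong)
    fix r assume r: "r \<in> heads n k"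
    then have rs: "r \<in> switch_seqs" by (simp add: heads_def)
    have "ennreal (switch_density p \<pi> xs (r @ l))
        = ennreal (seq_density p r xs * seqw r) * ennreal (pathw (fst (last r)) l * (1 - \<theta>))"
      if l: "l \<in> tails n" for l
      using nonneg[OF rs] theta
      by (simp add: switch_density_def seq_density_append_tail[OF r l n(2)]
          prior[OF append_tail_in_switch_seqs[OF r l]] seq_weight_append[OF rs]
          ennreal_mult[symmetric] seq_nonneg path_nonneg mult_ac)
    then have "(\<Sum>\<^sub>\<infinity>l\<in>tails n. ennreal (switch_density p \<pi> xs (r @ l)))
        = (\<Sum>\<^sub>\<infinity>l\<in>tails n. ennreal (seq_density p r xs * seqw r) * ennreal (pathw (fst (last r)) l * (1 - \<theta>)))"
      by (rule infsum_cong)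
    also have "\<dots> = ennreal (seq_density p r xs * seqw r) * ennreal (\<theta> * surv (fst (last r)) n + (1 - \<theta>))"
      by (simp only: infsum_ennreal_cmult continuation_mass)
    also have "\<dots> = ennreal (seq_density p r xs * seqw r * (\<theta> * surv (fst (last r)) n + (1 - \<theta>)))"
      using nonneg[OF rs] theta by (simp add: ennreal_mult seq_nonneg survival_nonneg)
    finally show "(\<Sum>\<^sub>\<infinity>l\<in>tails n. ennreal (switch_density p \<pi> xs (r @ l))) = \<dots>" .
  qed
  finally show ?thesis .
qed

end

section \<open>The invariant of the algorithm\<close>

locale switch_strategies = switch_weights \<pi>K \<pi>T \<theta> for \<pi>K \<pi>T \<theta> +
  fixes M :: "'x measure" and p :: "nat \<Rightarrow> 'x list \<Rightarrow> 'x \<Rightarrow> real"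
  assumes strategies: "\<And>k. 1 \<le> k \<Longrightarrow> prediction_strategy M (p k)"
begin

lemma density_nonneg: "1 \<le> k \<Longrightarrow> xs \<in> lists (space M) \<Longrightarrow> x \<in> space M \<Longrightarrow> 0 \<le> p k xs x"
  using strategies by (auto simp: prediction_strategy_def)

lemma seq_density_nonneg:
  assumes "s \<in> switch_seqs" "xs \<in> lists (space M)"
  shows "0 \<le> seq_density p s xs"
  unfolding seq_density_def
  using assms
  by (intro prod_nonneg ballI density_nonneg model_at_pos)
     (auto dest!: in_set_takeD simp: subset_iff)

text \<open>
  The weight of the head \<open>r\<close> together with all continuations that contain at least one further switch.
  The time \<open>n\<close> is a parameter because this weight shrinks while the next switch is awaited.
\<close>

definition live_weight :: "nat \<Rightarrow> 'x list \<Rightarrow> (nat \<times> nat) list \<Rightarrow> ennreal" where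
  "live_weight n xs r = ennreal (seq_density p r xs * seqw r * (\<theta> * surv (fst (last r)) n))"

definition final_weight :: "'x list \<Rightarrow> (nat \<times> nat) list \<Rightarrow> ennreal" where
  "final_weight xs r = ennreal (seq_density p r xs * seqw r * (1 - \<theta>))"

definition weights_correct :: "nat \<Rightarrow> 'x list \<Rightarrow> weights \<Rightarrow> bool" where
  "weights_correct n xs w \<longleftrightarrow> (\<forall>k\<ge>1.
    fst w k = infsum (live_weight n xs) (heads n k) \<and>
    snd w k = infsum (final_weight xs) (heads n k))"

lemma weights_correct_init:
  assumes "\<K> 1 = {1..}"
  shows "weights_correct 1 [] (switch_init \<K> \<theta> \<pi>K)"
proof -
  have "surv 0 (Suc 0) = 1" by (rule survival_Suc_self)
  then show ?thesis
    using theta assms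
    by (auto simp: weights_correct_def switch_init_def heads_Suc_0 live_weight_def
        final_weight_def seq_density_def seq_weight_def ennreal_mult)
qed

text \<open>
  The four ways in which the weight of a head develops in one round: it either persists or is extended
  by a switch at \<open>n\<close> to model \<open>k\<close>, and afterwards it either awaits a further switch or does not. Only
  live weight can be transferred by a switch.
\<close>

lemma
  assumes r: "r \<in> heads n j" and n: "n = Suc (length xs)" and j: "1 \<le> j"
    and xs: "xs \<in> lists (space M)" "x \<in> space M"
  shows live_weight_step: "live_weight (Suc n) (xs @ [x]) r =
      live_weight n xs r * (ennreal (p j xs x) * ennreal (1 - hazard \<pi>T n))"
    and final_weight_step: "final_weight (xs @ [x]) r = final_weight xs r * ennreal (p j xs x)"
    and live_weight_switch: "1 \<le> k \<Longrightarrow> live_weight (Suc n) (xs @ [x]) (r @ [(n, k)]) =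
      live_weight n xs r * (ennreal (p j xs x) * (ennreal (hazard \<pi>T n) * ennreal (pmf \<pi>K k) * ennreal \<theta>))"
    and final_weight_switch: "1 \<le> k \<Longrightarrow> final_weight (xs @ [x]) (r @ [(n, k)]) =
      live_weight n xs r * (ennreal (p j xs x) * (ennreal (hazard \<pi>T n) * ennreal (pmf \<pi>K k) * ennreal (1 - \<theta>)))"
proof -
  have rs: "r \<in> switch_seqs" using r by (simp add: heads_def)
  let ?t = "fst (last r)"
  have dens: "seq_density p r (xs @ [x]) = seq_density p r xs * p j xs x"
    using model_at_head[OF r] n by (simp add: seq_density_snoc)
  have pos: "0 \<le> seq_density p r xs" "0 \<le> seqw r" "0 \<le> p j xs x"
    using seq_density_nonneg[OF rs xs(1)] density_nonneg[OF j xs] by (simp_all add: seq_nonneg)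
  note nonneg = pos theta hazard_bounds[of n] survival_nonneg[of ?t n] cond_after_nonneg[of ?t n]
  show "final_weight (xs @ [x]) r = final_weight xs r * ennreal (p j xs x)"
    using nonneg by (simp add: final_weight_def dens ennreal_mult[symmetric] mult_ac)
  show "live_weight (Suc n) (xs @ [x]) r =
      live_weight n xs r * (ennreal (p j xs x) * ennreal (1 - hazard \<pi>T n))"
    using nonneg unfolding live_weight_def dens survival_no_hazard[symmetric]
    by (simp add: ennreal_mult[symmetric] mult_ac)
  assume k: "1 \<le> k"
  have dens': "seq_density p (r @ [(n, k)]) (xs @ [x]) = seq_density p r xs * p j xs x"
    using seq_density_append_tail[OF r singleton_tail[OF k], of "xs @ [x]"] n by (simp add: dens)
  have weight: "seqw (r @ [(n, k)]) = seqw r * (\<theta> * (surv ?t n * hazard \<pi>T n) * pmf \<pi>K k)"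
    by (simp add: seq_weight_append[OF rs] survival_hazard)
  show "live_weight (Suc n) (xs @ [x]) (r @ [(n, k)]) =
      live_weight n xs r * (ennreal (p j xs x) * (ennreal (hazard \<pi>T n) * ennreal (pmf \<pi>K k) * ennreal \<theta>))"
    using nonneg unfolding live_weight_def dens' weight
    by (simp add: survival_Suc_self ennreal_mult[symmetric] mult_ac)
  show "final_weight (xs @ [x]) (r @ [(n, k)]) =
      live_weight n xs r * (ennreal (p j xs x) * (ennreal (hazard \<pi>T n) * ennreal (pmf \<pi>K k) * ennreal (1 - \<theta>)))"
    using nonneg unfolding live_weight_def final_weight_def dens' weight
    by (simp add: ennreal_mult[symmetric] mult_ac)
qed

text \<open>
  The two summands of the update match the two parts of the decomposition of the heads at time \<open>n + 1\<close>;
  the pool collects the live weight of all heads that may switch at \<open>n\<close>, whatever their last model is.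
\<close>

lemma weights_correct_step:
  assumes w: "weights_correct n xs w" and n: "n = Suc (length xs)"
    and K: "\<K> n = {1..}" "\<K> (n + 1) = {1..}"
    and xs: "xs \<in> lists (space M)" "x \<in> space M"
  shows "weights_correct (Suc n) (xs @ [x]) (switch_step p \<K> \<theta> \<pi>K \<pi>T n xs x w)"
proof -
  have n1: "1 \<le> n" using n by simp
  (* the pool of the algorithm before multiplication by the hazard rate *)
  define mass where "mass = (\<Sum>\<^sub>\<infinity>j\<in>{1..}. infsum (live_weight n xs) (heads n j) * ennreal (p j xs x))"
  have mass_alg: "(\<Sum>\<^sub>\<infinity>j\<in>{1..}. (\<lambda>k\<in>{1..}. fst w k * ennreal (p k xs x)) j) = mass"
    unfolding mass_def using w by (intro infsum_cong) (auto simp: weights_correct_def)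
  (* c is the factor by which a switch changes the weight; it does not depend on the old model j *)
  have switch: "(\<Sum>\<^sub>\<infinity>j\<in>{1..}. \<Sum>\<^sub>\<infinity>r\<in>heads n j. f (r @ [(n, k)])) = mass * c"
    if f: "\<And>j r. 1 \<le> j \<Longrightarrow> r \<in> heads n j \<Longrightarrow>
      f (r @ [(n, k)]) = live_weight n xs r * (ennreal (p j xs x) * c)" for f k c
  proof -
    have "(\<Sum>\<^sub>\<infinity>r\<in>heads n j. f (r @ [(n, k)]))
        = infsum (live_weight n xs) (heads n j) * ennreal (p j xs x) * c" if j: "j \<in> {1..}" for j
    proof -
      have "(\<Sum>\<^sub>\<infinity>r\<in>heads n j. f (r @ [(n, k)]))
          = (\<Sum>\<^sub>\<infinity>r\<in>heads n j. live_weight n xs r * (ennreal (p j xs x) * c))"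
        using j by (intro infsum_cong f) auto
      then show ?thesis by (simp only: infsum_ennreal_multc mult.assoc)
    qed
    then have "(\<Sum>\<^sub>\<infinity>j\<in>{1..}. \<Sum>\<^sub>\<infinity>r\<in>heads n j. f (r @ [(n, k)]))
        = (\<Sum>\<^sub>\<infinity>j\<in>{1..}. infsum (live_weight n xs) (heads n j) * ennreal (p j xs x) * c)"
      by (rule infsum_cong)
    then show ?thesis by (simp only: infsum_ennreal_multc mass_def)
  qed
  show ?thesis
    unfolding weights_correct_def
  proof (intro allI impI conjI)
    fix k :: nat assume k: "1 \<le> k"
    note step = live_weight_step[OF _ n k xs] final_weight_step[OF _ n k xs]
    have "infsum (live_weight (Suc n) (xs @ [x])) (heads n k)
        = (\<Sum>\<^sub>\<infinity>r\<in>heads n k. live_weight n xs r * (ennreal (p k xs x) * ennreal (1 - hazard \<pi>T n)))"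
      by (intro infsum_cong step)
    then have "infsum (live_weight (Suc n) (xs @ [x])) (heads (Suc n) k)
        = infsum (live_weight n xs) (heads n k) * (ennreal (p k xs x) * ennreal (1 - hazard \<pi>T n))
          + mass * (ennreal (hazard \<pi>T n) * ennreal (pmf \<pi>K k) * ennreal \<theta>)"
      unfolding infsum_heads_Suc[OF n1 k]
      by (simp only: infsum_ennreal_multc
          switch[of "live_weight (Suc n) (xs @ [x])", OF live_weight_switch[OF _ n _ xs k]])
    then show "fst (switch_step p \<K> \<theta> \<pi>K \<pi>T n xs x w) k
        = infsum (live_weight (Suc n) (xs @ [x])) (heads (Suc n) k)"
      using w k unfolding switch_step_def Let_def K mass_alg
      by (simp add: weights_correct_def mult_ac)
    have "infsum (final_weight (xs @ [x])) (heads n k)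
        = (\<Sum>\<^sub>\<infinity>r\<in>heads n k. final_weight xs r * ennreal (p k xs x))"
      by (intro infsum_cong step)
    then have "infsum (final_weight (xs @ [x])) (heads (Suc n) k)
        = infsum (final_weight xs) (heads n k) * ennreal (p k xs x)
          + mass * (ennreal (hazard \<pi>T n) * ennreal (pmf \<pi>K k) * ennreal (1 - \<theta>))"
      unfolding infsum_heads_Suc[OF n1 k]
      by (simp only: infsum_ennreal_multc
          switch[of "final_weight (xs @ [x])", OF final_weight_switch[OF _ n _ xs k]])
    then show "snd (switch_step p \<K> \<theta> \<pi>K \<pi>T n xs x w) k
        = infsum (final_weight (xs @ [x])) (heads (Suc n) k)"
      using w k unfolding switch_step_def Let_def K mass_alg
      by (simp add: weights_correct_def mult_ac)
  qed
qed

lemma report_correct: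
  assumes w: "weights_correct n xs w" and n: "n = Suc (length xs)" and K: "\<K> n = {1..}"
    and xs: "xs \<in> lists (space M)" and k: "1 \<le> k"
    and prior: "\<And>s. s \<in> switch_seqs \<Longrightarrow> pmf \<pi> s = seqw s * (1 - \<theta>)"
  shows "switch_report \<K> n w k = switch_marginal p \<pi> n k xs"
proof -
  have marginal: "switch_marginal p \<pi> n k xs = (\<Sum>\<^sub>\<infinity>r\<in>heads n k.
      ennreal (seq_density p r xs * seqw r * (\<theta> * surv (fst (last r)) n + (1 - \<theta>))))"
    by (rule switch_marginal_eq_infsum_heads[OF _ _ prior seq_density_nonneg[OF _ xs]])
       (simp_all add: n)
  have "switch_report \<K> n w k = infsum (live_weight n xs) (heads n k) + infsum (final_weight xs) (heads n k)"
    using w k by (simp add: switch_report_def K weights_correct_def)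
  also have "\<dots> = (\<Sum>\<^sub>\<infinity>r\<in>heads n k. live_weight n xs r + final_weight xs r)"
    by (rule infsum_add[symmetric]) (simp_all add: nonneg_summable_on_complete)
  also have "\<dots> = switch_marginal p \<pi> n k xs"
    unfolding marginal live_weight_def final_weight_def
  proof (rule infsum_cong)
    fix r assume "r \<in> heads n k"
    then have "r \<in> switch_seqs" by (simp add: heads_def)
    then have "0 \<le> seq_density p r xs * seqw r"
      using seq_density_nonneg[OF _ xs] by (simp add: seq_nonneg)
    then show "ennreal (seq_density p r xs * seqw r * (\<theta> * surv (fst (last r)) n))
          + ennreal (seq_density p r xs * seqw r * (1 - \<theta>))
        = ennreal (seq_density p r xs * seqw r * (\<theta> * surv (fst (last r)) n + (1 - \<theta>)))"
      using theta
      by (subst ennreal_plus[symmetric]) (auto simp: survival_nonneg distrib_left)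
  qed
  finally show ?thesis .
qed

lemma switch_run_correct:
  assumes "weights_correct n xs w" "n = Suc (length xs)"
    and K: "\<And>n. 1 \<le> n \<Longrightarrow> \<K> n = {1..}"
    and "xs \<in> lists (space M)" "ys \<in> lists (space M)"
    and prior: "\<And>s. s \<in> switch_seqs \<Longrightarrow> pmf \<pi> s = seqw s * (1 - \<theta>)"
  shows "length (switch_run p \<K> \<theta> \<pi>K \<pi>T n xs w ys) = Suc (length ys) \<and>
    (\<forall>i \<le> length ys. \<forall>k \<ge> 1. (switch_run p \<K> \<theta> \<pi>K \<pi>T n xs w ys ! i) k =
      switch_marginal p \<pi> (n + i) k (xs @ take i ys))"
  using assms(1,2,4,5)
proof (induction ys arbitrary: n xs w)
  case Nil
  then show ?case
    using report_correct[OF Nil(1,2) K Nil(3) _ prior] by simp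
next
  case (Cons y ys)
  have now: "switch_report \<K> n w k = switch_marginal p \<pi> n k xs" if "1 \<le> k" for k
    using report_correct[OF Cons.prems(1,2) K Cons.prems(3) that prior] Cons.prems(2) by simp
  have "weights_correct (Suc n) (xs @ [y]) (switch_step p \<K> \<theta> \<pi>K \<pi>T n xs y w)"
    using weights_correct_step[OF Cons.prems(1,2) K K Cons.prems(3)] Cons.prems(2,4) by simp
  from Cons.IH[OF this] Cons.prems now show ?case
    by (auto simp: nth_Cons' take_Cons' split: nat.splits)
qed

end

theorem theorem14:
  fixes M :: "'x measure"
    and p :: "nat \<Rightarrow> 'x list \<Rightarrow> 'x \<Rightarrow> real"
    and \<K> :: "nat \<Rightarrow> nat set"
    and \<pi> :: "(nat \<times> nat) list pmf"
    and \<pi>M \<pi>K \<pi>T :: "nat pmf"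
    and \<theta> :: real
    and N :: nat
    and xs :: "'x list"
  assumes strategies: "\<And>k. 1 \<le> k \<Longrightarrow> prediction_strategy M (p k)"
    and K_pos: "\<And>n. 1 \<le> n \<Longrightarrow> \<K> n \<subseteq> {1..}"
    and K_mono: "\<And>n. 1 \<le> n \<Longrightarrow> \<K> n \<subseteq> \<K> (n + 1)"
    and prior_on_seqs: "set_pmf \<pi> \<subseteq> switch_seqs"
    and prior_form: "\<And>s. s \<in> switch_seqs \<Longrightarrow> pmf \<pi> s = switch_prior \<pi>M \<pi>K \<pi>T s"
    and supp_K: "set_pmf \<pi>K = {1..}"
    and supp_T: "set_pmf \<pi>T = {1..}"
    and theta: "0 \<le> \<theta>" "\<theta> < 1"
    and supp_M: "set_pmf \<pi>M \<subseteq> {1..}" "0 < \<theta> \<Longrightarrow> set_pmf \<pi>M = {1..}"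
    and geometric: "\<And>m. 1 \<le> m \<Longrightarrow> pmf \<pi>M m = \<theta> ^ (m - 1) * (1 - \<theta>)"
    and prior_allowed: "measure_pmf.prob \<pi> (switch_seqs - allowed_seqs \<K>) = 0"
    and outcomes: "xs \<in> lists (space M)" "length xs = N"
  shows "length (switch_algorithm p \<K> \<theta> \<pi>K \<pi>T xs) = N + 1 \<and>
    (\<forall>n \<in> {1..N + 1}. \<forall>k \<in> \<K> n.
      (switch_algorithm p \<K> \<theta> \<pi>K \<pi>T xs ! (n - 1)) k =
        switch_marginal p \<pi> n k (take (n - 1) xs))"
proof -
  interpret switch_strategies \<pi>K \<pi>T \<theta> M p
    using supp_K supp_T theta strategies by unfold_locales auto
  have prior: "pmf \<pi> s = seq_weight \<theta> \<pi>K \<pi>T s * (1 - \<theta>)" if "s \<in> switch_seqs" for s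
    using prior_form[OF that] switch_prior_eq_seq_weight[OF that geometric] by simp
  (* the sequence [(0, k)] has positive prior probability and uses model k at all times *)
  have K: "\<K> n = {1..}" if n: "1 \<le> n" for n
  proof (intro equalityI K_pos[OF n] subsetI)
    fix k :: nat assume k: "k \<in> {1..}"
    then have head: "[(0, k)] \<in> heads n k" and s: "[(0, k)] \<in> switch_seqs"
      using n by (auto simp: heads_def switch_seqs_def)
    have "k \<in> set_pmf \<pi>K" using k supp_K by simp
    then have "0 < pmf \<pi> [(0, k)]"
      using theta by (simp add: prior[OF s] seq_weight_def pmf_positive)
    then have "[(0, k)] \<in> set_pmf \<pi>" by (simp add: set_pmf_iff)
    with prior_allowed s have "[(0, k)] \<in> allowed_seqs \<K>"
      unfolding measure_pmf_zero_iff by blast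
    then show "k \<in> \<K> n"
      using n model_at_head[OF head n] by (auto simp: allowed_seqs_def)
  qed
  have "weights_correct 1 [] (switch_init \<K> \<theta> \<pi>K)"
    using weights_correct_init K by simp
  from switch_run_correct[OF this _ K _ outcomes(1) prior]
  have run: "length (switch_algorithm p \<K> \<theta> \<pi>K \<pi>T xs) = Suc (length xs)"
    "\<And>i k. i \<le> length xs \<Longrightarrow> 1 \<le> k \<Longrightarrow>
      (switch_algorithm p \<K> \<theta> \<pi>K \<pi>T xs ! i) k = switch_marginal p \<pi> (1 + i) k (take i xs)"
    by (auto simp: switch_algorithm_def)
  show ?thesis
  proof (intro conjI ballI)
    show "length (switch_algorithm p \<K> \<theta> \<pi>K \<pi>T xs) = N + 1"
      using run(1) outcomes(2) by simp
    fix n k assume "n \<in> {1..N + 1}" "k \<in> \<K> n"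
    then show "(switch_algorithm p \<K> \<theta> \<pi>K \<pi>T xs ! (n - 1)) k
        = switch_marginal p \<pi> n k (take (n - 1) xs)"
      using run(2)[of "n - 1" k] K[of n] outcomes(2) by auto
  qed
qed

end
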